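(* For every positive integer $n$, $$\tau(n)=\frac{n^2-5n+2}{4\displaystyle\sum_{j=1}^{n-1}\ \sum_{\substack{1\le k\le n\\ \gcd(k,n)=1}}\left\lfloor\frac{j(k-1)}{n}\right\rfloor-2\displaystyle\sum_{\substack{1\le k\le n\\ \gcd(k,n)=1}}\gcd(k-1,n)}\ \cdot\sum_{\substack{1\le k\le n\\ \gcd(k,n)=1}}\gcd(k-1,n) .$$
   Context: $\tau(n)=\sum_{d\mid n}1$ is the number of positive divisors of $n$. $\lfloor x\rfloor$ denotes the integer part (floor) of $x$. The convention $\gcd(0,n)=n$ is used, and empty sums are $0$. *)

theory Defs
  imports Complex_Main
begin

definition tau :: "nat \<Rightarrow> nat" where
  "tau n = (\<Sum>d | d dvd n. 1)"

end

(*
  Menon's identity evaluates the sum of gcd(k - 1, n) over the units k modulo n as phi(n) tau(n):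
  expand gcd(k - 1, n) as the sum of phi(d) over the common divisors d, and note that phi(n)/phi(d)
  units modulo n are congruent to 1 modulo d, because the units modulo n surject onto those
  modulo d.  Pairing j with n - j gives
    2 * sum_{0<j<n} floor(j m / n) = (m - 1)(n - 1) + gcd(m, n) - 1,
  and summing over m = k - 1, where the units k have mean n/2 if n > 1, turns the denominator
  into phi(n) (n^2 - 5 n + 2).  It is nonzero because n^2 - 5 n + 2 has no integer root.
*)
theory Submission
  imports Defs "HOL-Number_Theory.Number_Theory"
begin

section \<open>Units modulo n and their reduction modulo a divisor d\<close>

definition reduced_residues :: "nat \<Rightarrow> nat set" where
  "reduced_residues n = {a. a < n \<and> coprime a n}"

lemma finite_reduced_residues [simp]: "finite (reduced_residues n)"
  unfolding reduced_residues_def by simp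

text \<open>For n = 1 the sets differ: {0} against {1}. Representatives below the modulus are chosen
  so that \<open>k mod d\<close> lies in \<open>reduced_residues d\<close> even when d = 1.\<close>

lemma reduced_residues_eq_totatives: "n > 1 \<Longrightarrow> reduced_residues n = totatives n"
  by (auto simp: reduced_residues_def in_totatives_iff dest: totatives_less
      intro!: Nat.gr0I)

lemma card_reduced_residues: "n > 0 \<Longrightarrow> card (reduced_residues n) = totient n"
proof (cases "n = 1")
  case True
  then have "reduced_residues n = {0}"
    by (auto simp: reduced_residues_def)
  with True show ?thesis by simp
qed (simp add: reduced_residues_eq_totatives totient_def)

lemma lift_coprime_to_multiple:
  fixes a d n :: nat
  assumes "n > 0" "coprime a d"
  obtains b where "coprime b n" "[b = a] (mod d)"
proof -
  \<comment> \<open>A prime factor of \<open>n\<close> divides exactly one of \<open>a\<close> and \<open>t\<close>, so it cannot divide \<open>a + d * t\<close>.\<close>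
  define t where "t = \<Prod>{p \<in> prime_factors n. \<not> p dvd a}"
  have t: "p dvd t \<longleftrightarrow> \<not> p dvd a" if "prime p" "p dvd n" for p
  proof -
    have "p dvd t \<longleftrightarrow> (\<exists>q\<in>{p \<in> prime_factors n. \<not> p dvd a}. p dvd q)"
      unfolding t_def using that by (intro prime_dvd_prod_iff) auto
    also have "\<dots> \<longleftrightarrow> \<not> p dvd a"
      using that \<open>n > 0\<close> by (auto simp: prime_factors_dvd dest: primes_dvd_imp_eq)
    finally show ?thesis .
  qed
  have "coprime (a + d * t) n"
  proof (rule ccontr)
    assume "\<not> coprime (a + d * t) n"
    then have "gcd (a + d * t) n \<noteq> 1"
      by (simp only: coprime_iff_gcd_eq_1 not_False_eq_True)
    then obtain p where "prime p" "p dvd gcd (a + d * t) n"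
      using prime_factor_nat by blast
    then have p: "prime p" "p dvd a + d * t" "p dvd n"
      by simp_all
    show False
    proof (cases "p dvd a")
      case True
      with p have "p dvd d * t" by (simp add: dvd_add_right_iff)
      with p t True have "p dvd d" by (auto simp: prime_dvd_mult_iff)
      with True p(1) assms(2) show False by (meson coprime_common_divisor not_prime_unit)
    next
      case False
      with p t have "p dvd d * t" by simp
      with p False show False by (simp add: dvd_add_left_iff)
    qed
  qed
  moreover have "[a + d * t = a] (mod d)" by (simp add: cong_def)
  ultimately show thesis using that by blast
qed

text \<open>The fibre over the class of \<open>a\<close> under reduction from units modulo n to
  residues modulo d. Any representative \<open>a\<close> is allowed, so products such as
  \<open>c * a\<close> need no reduction.\<close>

definition residue_fibre :: "nat \<Rightarrow> nat \<Rightarrow> nat \<Rightarrow> nat set" where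
  "residue_fibre n d a = {k \<in> reduced_residues n. [k = a] (mod d)}"

lemma finite_residue_fibre [simp]: "finite (residue_fibre n d a)"
  unfolding residue_fibre_def by simp

text \<open>Lift \<open>c\<close> to a unit \<open>b\<close> modulo n. Multiplication by
  \<open>b\<close> is injective modulo n and carries the fibre over \<open>a\<close> into the fibre
  over \<open>c * a\<close>.\<close>

lemma card_residue_fibre_le:
  assumes "n > 0" "d dvd n" "coprime c d"
  shows "card (residue_fibre n d a) \<le> card (residue_fibre n d (c * a))"
proof -
  from assms obtain b where b: "coprime b n" "[b = c] (mod d)"
    by (metis lift_coprime_to_multiple)
  let ?f = "\<lambda>k. (b * k) mod n"
  have "inj_on ?f (residue_fibre n d a)"
  proof (rule inj_onI)
    fix k l assume kl: "k \<in> residue_fibre n d a" "l \<in> residue_fibre n d a" "?f k = ?f l"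
    then have "[k = l] (mod n)"
      using b by (metis cong_def cong_mult_lcancel_nat)
    with kl show "k = l"
      by (simp add: residue_fibre_def reduced_residues_def cong_def)
  qed
  moreover have "?f ` residue_fibre n d a \<subseteq> residue_fibre n d (c * a)"
  proof
    fix y assume "y \<in> ?f ` residue_fibre n d a"
    then obtain k where k: "k \<in> residue_fibre n d a" "y = ?f k" by blast
    then have "coprime (b * k) n" "[k = a] (mod d)"
      using b by (auto simp: residue_fibre_def reduced_residues_def)
    then have "coprime y n" "y < n"
      using k(2) \<open>n > 0\<close> by (simp_all add: coprime_commute)
    moreover have "[y = b * k] (mod d)"
      using k(2) \<open>d dvd n\<close> by (simp add: cong_def mod_mod_cancel)
    then have "[y = c * a] (mod d)"
      using b(2) \<open>[k = a] (mod d)\<close> by (meson cong_mult cong_trans)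
    ultimately show "y \<in> residue_fibre n d (c * a)"
      by (simp add: residue_fibre_def reduced_residues_def)
  qed
  ultimately show ?thesis
    by (intro card_inj_on_le) auto
qed

text \<open>Multiplying by \<open>a\<close> leads from the fibre over 1 to the fibre over
  \<open>a\<close>, and multiplying by an inverse of \<open>a\<close> modulo d leads back, so the
  previous inequality applies in both directions.\<close>

lemma card_residue_fibre_eq:
  assumes "n > 0" "d dvd n" "coprime a d"
  shows "card (residue_fibre n d a) = card (residue_fibre n d 1)"
proof (rule antisym)
  obtain b where b: "[a * b = 1] (mod d)"
    using assms(3) cong_solve_coprime_nat by auto
  then have "coprime b d"
    using cong_imp_coprime[of 1 "a * b" d] by (simp add: cong_sym)
  then have "card (residue_fibre n d a) \<le> card (residue_fibre n d (b * a))"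
    using assms by (intro card_residue_fibre_le)
  also have "residue_fibre n d (b * a) = residue_fibre n d 1"
    using b unfolding residue_fibre_def by (metis cong_sym cong_trans mult.commute)
  finally show "card (residue_fibre n d a) \<le> card (residue_fibre n d 1)" .
  show "card (residue_fibre n d 1) \<le> card (residue_fibre n d a)"
    using card_residue_fibre_le[OF assms, of 1] by simp
qed

text \<open>The units modulo n split into disjoint fibres over the \<open>totient d\<close> units
  modulo d, all as large as the fibre over 1.\<close>

lemma totient_mult_card_residue_fibre:
  assumes "n > 0" "d dvd n"
  shows "totient d * card (residue_fibre n d 1) = totient n"
proof -
  have "d > 0" using assms by (auto intro: Nat.gr0I)
  have "reduced_residues n = (\<Union>a\<in>reduced_residues d. residue_fibre n d a)"
  proof safe
    fix k assume k: "k \<in> reduced_residues n"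
    then have "coprime k d"
      using assms(2) by (auto simp: reduced_residues_def dest: coprime_divisors[of k k d n])
    then have "k mod d \<in> reduced_residues d"
      using \<open>d > 0\<close> by (simp add: reduced_residues_def coprime_commute)
    moreover have "k \<in> residue_fibre n d (k mod d)"
      using k by (simp add: residue_fibre_def cong_def)
    ultimately show "k \<in> (\<Union>a\<in>reduced_residues d. residue_fibre n d a)" by blast
  qed (simp add: residue_fibre_def)
  then have "totient n = card (\<Union>a\<in>reduced_residues d. residue_fibre n d a)"
    using card_reduced_residues[OF assms(1)] by simp
  also have "\<dots> = (\<Sum>a\<in>reduced_residues d. card (residue_fibre n d a))"
    by (rule card_UN_disjoint) (auto simp: residue_fibre_def reduced_residues_def cong_def)
  also have "\<dots> = (\<Sum>a\<in>reduced_residues d. card (residue_fibre n d 1))"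
    using assms by (intro sum.cong refl card_residue_fibre_eq) (auto simp: reduced_residues_def)
  finally show ?thesis
    using card_reduced_residues[OF \<open>d > 0\<close>] by simp
qed

section \<open>Menon's identity\<close>

theorem menon_identity:
  assumes "n > 0"
  shows "(\<Sum>k\<in>totatives n. gcd (k - 1) n) = totient n * card {d. d dvd n}"
proof (cases "n = 1")
  case True
  then show ?thesis by simp
next
  case False
  with assms have "n > 1" by simp
  have [simp]: "finite {d. d dvd n}" using assms by simp
  \<comment> \<open>After the sums over k and d are swapped, this set is the range of k for fixed d.
    Totatives are at least 1, so the truncated \<open>k - 1\<close> is a true difference; n > 1 lets
    totatives serve as reduced residues.\<close>
  have fibre: "{k \<in> totatives n. d dvd k - 1} = residue_fibre n d 1" for d
  proof -
    have "d dvd k - 1 \<longleftrightarrow> [k = 1] (mod d)" if "k \<in> totatives n" for k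
      using that by (metis One_nat_def Suc_leI cong_altdef_nat in_totatives_iff)
    then show ?thesis
      using \<open>n > 1\<close> by (auto simp: residue_fibre_def reduced_residues_eq_totatives)
  qed
  have "(\<Sum>k\<in>totatives n. gcd (k - 1) n) =
      (\<Sum>k\<in>totatives n. \<Sum>d | d dvd gcd (k - 1) n. totient d)"
    by (simp only: totient_divisor_sum)
  also have "\<dots> = (\<Sum>k\<in>totatives n. \<Sum>d | d \<in> {d. d dvd n} \<and> d dvd k - 1. totient d)"
    by (intro sum.cong) auto
  also have "\<dots> = (\<Sum>d | d dvd n. \<Sum>k | k \<in> totatives n \<and> d dvd k - 1. totient d)"
    by (rule sum.swap_restrict) auto
  also have "\<dots> = (\<Sum>d | d dvd n. totient n)"
    using totient_mult_card_residue_fibre[OF assms]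
    by (intro sum.cong refl) (simp only: fibre sum_constant of_nat_id mult.commute mem_Collect_eq)
  finally show ?thesis by simp
qed

section \<open>Sums of floors over j, and the mean of the totatives\<close>

lemma card_dvd_mult:
  fixes m n :: nat
  assumes "n > 0"
  shows "card {j \<in> {1..n}. n dvd j * m} = gcd m n"
proof -
  define g where "g = gcd m n"
  have "g > 0" using assms by (simp add: g_def)
  obtain m' n' where mn: "m = m' * g" "n = n' * g" "coprime m' n'"
    unfolding g_def using assms by (metis gcd_coprime_exists gcd_pos_nat less_irrefl)
  have "n' > 0" using mn assms by (auto intro: Nat.gr0I)
  \<comment> \<open>Cancelling \<open>g\<close> leaves n' dividing j * m' with m' and n' coprime.
    Since n = n' * g, the j sought are the first \<open>g\<close> multiples of n'.\<close>
  have "n dvd j * m \<longleftrightarrow> n' dvd j" for j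
    using mn \<open>g > 0\<close> by (simp add: mult.assoc[symmetric] coprime_dvd_mult_left_iff coprime_commute)
  then have "{j \<in> {1..n}. n dvd j * m} = (\<lambda>i. n' * i) ` {1..g}"
    using mn \<open>n' > 0\<close> by (auto elim!: dvdE simp: image_iff)
  also have "card \<dots> = g"
    using \<open>n' > 0\<close> by (subst card_image) (auto simp: inj_on_def)
  finally show ?thesis unfolding g_def .
qed

text \<open>The multiple \<open>y * n\<close> contributes exactly y, and the floors of x/n and -x/n
  add up to 0 or -1. With x = j m and y = m this treats the pair j, n - j.\<close>

lemma div_add_div_complement:
  fixes x y n :: int
  assumes "n > 0"
  shows "x div n + (y * n - x) div n = y - (if n dvd x then 0 else 1)"
proof -
  have "(y * n - x) div n = y + (- x) div n"
    using assms by (metis add.commute diff_conv_add_uminus div_mult_self1 less_irrefl)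
  then show ?thesis
    using assms by (simp add: zdiv_zminus1_eq_if dvd_eq_mod_eq_0)
qed

text \<open>Stated over the integers because m = 0 occurs (for k = 1), where the factor m - 1 is
  -1.\<close>

lemma twice_sum_div:
  assumes "n > 0"
  shows "2 * (\<Sum>j=1..n-1. int j * int m div int n) =
    (int m - 1) * (int n - 1) + int (gcd m n) - 1"
proof -
  let ?f = "\<lambda>j. int j * int m div int n"
  have flip: "(\<Sum>j=1..n-1. ?f j) = (\<Sum>j=1..n-1. ?f (n - j))"
    by (rule sum.reindex_bij_witness[of _ "\<lambda>j. n - j" "\<lambda>j. n - j"]) auto
  \<comment> \<open>The index j = n always satisfies the divisibility; leaving it out accounts for
    the -1.\<close>
  have card: "int (card {j \<in> {1..n-1}. n dvd j * m}) = int (gcd m n) - 1"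
  proof -
    have "{j \<in> {1..n}. n dvd j * m} = insert n {j \<in> {1..n-1}. n dvd j * m}"
      using assms by auto
    moreover have "card (insert n {j \<in> {1..n-1}. n dvd j * m}) =
        Suc (card {j \<in> {1..n-1}. n dvd j * m})"
      using assms by (subst card_insert_disjoint) auto
    ultimately show ?thesis using card_dvd_mult[OF assms, of m] by simp
  qed
  have pair: "?f j + ?f (n - j) = int m - 1 + (if n dvd j * m then 1 else 0)"
    if "j \<in> {1..n-1}" for j
  proof -
    have "j \<le> n" using that by auto
    then have "int (n - j) * int m = int m * int n - int j * int m"
      by (simp add: algebra_simps)
    moreover have "int n dvd int j * int m \<longleftrightarrow> n dvd j * m"
      by (metis int_dvd_int_iff of_nat_mult)
    ultimately show ?thesis
      using div_add_div_complement[of "int n" "int j * int m" "int m"] assms by simp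
  qed
  have "2 * (\<Sum>j=1..n-1. ?f j) = (\<Sum>j=1..n-1. ?f j + ?f (n - j))"
    using flip by (simp add: sum.distrib)
  also have "\<dots> = (\<Sum>j=1..n-1. int m - 1 + (if n dvd j * m then 1 else 0))"
    by (intro sum.cong refl pair)
  also have "\<dots> = int (n - 1) * (int m - 1) + int (card {j \<in> {1..n-1}. n dvd j * m})"
    by (simp add: sum.distrib flip: sum.inter_filter)
  also have "\<dots> = (int m - 1) * (int n - 1) + int (gcd m n) - 1"
    unfolding card using assms by (simp add: Suc_leI)
  finally show ?thesis .
qed

text \<open>The reflection of k to n - k is an involution on the totatives. It fails for n = 1,
  where the equation would read 2 = 1.\<close>

lemma twice_sum_totatives:
  assumes "n > 1"
  shows "2 * (\<Sum>k\<in>totatives n. k) = n * totient n"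
proof -
  have lt: "k < n" if "k \<in> totatives n" for k
    using totatives_less[OF that] assms by simp
  have coprime: "coprime (n - k) n" if "k \<in> totatives n" for k
  proof (rule coprimeI)
    fix c assume "c dvd n - k" "c dvd n"
    then have "c dvd k"
      using lt[OF that] by (metis diff_diff_cancel dvd_diff_nat less_imp_le)
    with \<open>c dvd n\<close> show "is_unit c"
      using that by (meson coprime_common_divisor in_totatives_iff)
  qed
  have "(\<Sum>k\<in>totatives n. k) = (\<Sum>k\<in>totatives n. n - k)"
    by (rule sum.reindex_bij_witness[of _ "\<lambda>k. n - k" "\<lambda>k. n - k"])
      (use lt coprime in \<open>auto simp: in_totatives_iff less_imp_le\<close>)
  then have "2 * (\<Sum>k\<in>totatives n. k) = (\<Sum>k\<in>totatives n. k + (n - k))"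
    by (simp only: sum.distrib mult_2)
  also have "\<dots> = (\<Sum>k\<in>totatives n. n)"
    using lt by (intro sum.cong refl) (simp add: less_imp_le)
  finally show ?thesis by (simp add: totient_def)
qed

text \<open>An integer root would satisfy n (5 - n) = 2, hence divide 2, and the few candidates
  fail. This keeps the denominator of the final quotient from vanishing.\<close>

lemma quadratic_nonzero:
  fixes n :: int
  shows "n\<^sup>2 - 5 * n + 2 \<noteq> 0"
proof
  assume "n\<^sup>2 - 5 * n + 2 = 0"
  then have eq: "n * (5 - n) = 2" by (simp add: power2_eq_square algebra_simps)
  then have "n dvd 2" by (metis dvd_triv_left)
  then have "n \<in> {-2..2}" using zdvd_imp_le[of n 2] zdvd_imp_le[of "-n" 2] by auto
  then have "n = -2 \<or> n = -1 \<or> n = 0 \<or> n = 1 \<or> n = 2" by auto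
  with eq show False by auto
qed

section \<open>Evaluation of the denominator\<close>

theorem mainTheorem7:
  fixes n :: nat
  assumes "n > 0"
  shows "real (tau n) =
    ((real n)\<^sup>2 - 5 * real n + 2) /
    (4 * (\<Sum>j = 1..n - 1. \<Sum>k | 1 \<le> k \<and> k \<le> n \<and> gcd k n = 1.
            real_of_int \<lfloor>real j * real (k - 1) / real n\<rfloor>)
      - 2 * (\<Sum>k | 1 \<le> k \<and> k \<le> n \<and> gcd k n = 1. real (gcd (k - 1) n)))
    * (\<Sum>k | 1 \<le> k \<and> k \<le> n \<and> gcd k n = 1. real (gcd (k - 1) n))"
proof -
  have T: "{k. 1 \<le> k \<and> k \<le> n \<and> gcd k n = 1} = totatives n"
    unfolding totatives_def coprime_iff_gcd_eq_1 by auto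
  let ?S = "\<Sum>j = 1..n - 1. \<Sum>k\<in>totatives n. real_of_int \<lfloor>real j * real (k - 1) / real n\<rfloor>"
  let ?G = "\<Sum>k\<in>totatives n. real (gcd (k - 1) n)"
  have G: "?G = real (totient n) * real (tau n)"
    using menon_identity[OF assms] by (simp add: tau_def flip: of_nat_sum of_nat_mult)
  have inner: "2 * (\<Sum>j = 1..n - 1. real_of_int \<lfloor>real j * real m / real n\<rfloor>) =
      (real m - 1) * (real n - 1) + real (gcd m n) - 1" for m
  proof -
    have "\<lfloor>real j * real m / real n\<rfloor> = int j * int m div int n" for j
      using floor_divide_of_nat_eq[of "j * m" n, where ?'a = real] by (simp add: zdiv_int)
    then show ?thesis
      using arg_cong[OF twice_sum_div[OF assms, of m], of real_of_int] by simp
  qed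
  \<comment> \<open>Here m = k - 1, so the factor m - 1 becomes k - 2; this uses k \<ge> 1.\<close>
  have S: "2 * ?S = (\<Sum>k\<in>totatives n. (real k - 2) * (real n - 1) + real (gcd (k - 1) n) - 1)"
  proof -
    have "2 * ?S = (\<Sum>k\<in>totatives n.
        2 * (\<Sum>j = 1..n - 1. real_of_int \<lfloor>real j * real (k - 1) / real n\<rfloor>))"
      by (subst sum.swap) (simp only: sum_distrib_left)
    also have "\<dots> = (\<Sum>k\<in>totatives n. (real k - 2) * (real n - 1) + real (gcd (k - 1) n) - 1)"
      by (intro sum.cong refl, subst inner) (auto simp: in_totatives_iff of_nat_diff)
    finally show ?thesis .
  qed
  have D: "4 * ?S - 2 * ?G = real (totient n) * ((real n)\<^sup>2 - 5 * real n + 2)"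
  proof (cases "n = 1")
    case True
    then show ?thesis by simp
  next
    case False
    with assms have "n > 1" by simp
    have K: "2 * (\<Sum>k\<in>totatives n. real k) = real n * real (totient n)"
      using arg_cong[OF twice_sum_totatives[OF \<open>n > 1\<close>], of real] by simp
    have "2 * ?S = ((\<Sum>k\<in>totatives n. real k) - 2 * real (totient n)) * (real n - 1)
        + ?G - real (totient n)"
      by (subst S) (simp add: sum.distrib sum_subtractf totient_def flip: sum_distrib_right)
    \<comment> \<open>Doubling the formula for \<open>2 * ?S\<close> produces \<open>2 * ?G\<close>,
      so the gcd sums cancel. Inserting \<open>K\<close> then leaves \<open>totient n\<close> times
      (n - 4)(n - 1) - 2, the required quadratic.\<close>
    then have "4 * ?S - 2 * ?G =
        (2 * (\<Sum>k\<in>totatives n. real k) - 4 * real (totient n)) * (real n - 1) - 2 * real (totient n)"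
      by (simp add: algebra_simps)
    then show ?thesis
      unfolding K by (simp add: power2_eq_square algebra_simps)
  qed
  have "(real n)\<^sup>2 - 5 * real n + 2 = real_of_int ((int n)\<^sup>2 - 5 * int n + 2)" by simp
  then have "(real n)\<^sup>2 - 5 * real n + 2 \<noteq> 0"
    using quadratic_nonzero[of "int n"] by (metis of_int_eq_0_iff)
  \<comment> \<open>Both the quadratic and \<open>totient n\<close> are nonzero, so they cancel and
    leave \<open>tau n\<close>.\<close>
  then show ?thesis
    unfolding T D unfolding G using assms by simp
qed

end
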